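(* Let $\mu$ be a positive Borel measure on a $CAT(0)$ space $(X,d)$ such that there exists a point $x_0\in X$ satisfying $$\int_X (1+d(x_0,z))^2\,d\mu(z)<+\infty ,$$ and consider the associated function (the Leibniz function) $B_\mu(x)=\int_X d(x,z)^2\,d\mu(z)$ on $X$. This function is continuous on $X$, and $B_\mu(x)\to+\infty$ when $d(x,x_0)\to+\infty$. Moreover: (i) the function $B_\mu$ has a unique minimum point $\operatorname{bar}[\mu]$, called the barycentre of $\mu$; (ii) for every $x\in X$, $$d(\operatorname{bar}[\mu],x)^2\cdot\mu(X)\le B_\mu(x)-B_\mu(\operatorname{bar}[\mu]).$$
   Context: A $CAT(0)$ space is a geodesic metric space in which every geodesic triangle is at least as thin as its Euclidean comparison triangle.
   Formalization: Parts (i) and (ii) are stated for complete CAT(0) spaces, since without completeness a minimum point of B_μ need not exist (e.g. finitely supported sequences with the l² norm); "positive measure" is read as nonzero, μ(X) > 0, since the claims fail for μ = 0. *)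

theory Defs
  imports "HOL-Analysis.Analysis"
begin

context metric_space
begin

definition geodesic_path :: "'a \<Rightarrow> 'a \<Rightarrow> (real \<Rightarrow> 'a) \<Rightarrow> bool" where
  "geodesic_path x y g \<longleftrightarrow>
     g 0 = x \<and> g (dist x y) = y \<and>
     (\<forall>s\<in>{0..dist x y}. \<forall>t\<in>{0..dist x y}. dist (g s) (g t) = \<bar>s - t\<bar>)"

definition geodesic_segment :: "'a \<Rightarrow> 'a \<Rightarrow> 'a set \<Rightarrow> bool" where
  "geodesic_segment x y S \<longleftrightarrow> (\<exists>g. geodesic_path x y g \<and> S = g ` {0..dist x y})"

definition geodesic_triangle ::
    "'a \<Rightarrow> 'a \<Rightarrow> 'a \<Rightarrow> 'a set \<Rightarrow> 'a set \<Rightarrow> 'a set \<Rightarrow> bool" where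
  "geodesic_triangle p q r S T U \<longleftrightarrow>
     geodesic_segment p q S \<and> geodesic_segment q r T \<and> geodesic_segment r p U"

definition comparison_triangle ::
    "'a \<Rightarrow> 'a \<Rightarrow> 'a \<Rightarrow> real ^ 2 \<Rightarrow> real ^ 2 \<Rightarrow> real ^ 2 \<Rightarrow> bool" where
  "comparison_triangle p q r p' q' r' \<longleftrightarrow>
     dist p' q' = dist p q \<and> dist q' r' = dist q r \<and> dist r' p' = dist r p"

definition comparison_on_side ::
    "'a \<Rightarrow> 'a set \<Rightarrow> real ^ 2 \<Rightarrow> real ^ 2 \<Rightarrow> 'a \<Rightarrow> real ^ 2 \<Rightarrow> bool" where
  "comparison_on_side p S p' q' x x' \<longleftrightarrow>
     x \<in> S \<and> x' \<in> closed_segment p' q' \<and> dist p' x' = dist p x"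

definition comparison_point ::
    "'a \<Rightarrow> 'a \<Rightarrow> 'a \<Rightarrow> 'a set \<Rightarrow> 'a set \<Rightarrow> 'a set \<Rightarrow>
     real ^ 2 \<Rightarrow> real ^ 2 \<Rightarrow> real ^ 2 \<Rightarrow> 'a \<Rightarrow> real ^ 2 \<Rightarrow> bool" where
  "comparison_point p q r S T U p' q' r' x x' \<longleftrightarrow>
     comparison_on_side p S p' q' x x' \<or>
     comparison_on_side q T q' r' x x' \<or>
     comparison_on_side r U r' p' x x'"

end

text \<open>Completeness is not part of the definition. Comparison triangles always exist and are
  unique up to isometry of the plane, so quantifying universally over them in the
  thinness axiom is the same as fixing one of them.\<close>

class cat0_space = metric_space +
  assumes geodesic_space: "\<exists>g. geodesic_path x y g"
    and triangles_thin:
      "geodesic_triangle p q r S T U \<Longrightarrow> comparison_triangle p q r p' q' r' \<Longrightarrow>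
       comparison_point p q r S T U p' q' r' x x' \<Longrightarrow>
       comparison_point p q r S T U p' q' r' y y' \<Longrightarrow>
       dist x y \<le> dist x' y'"

definition leibniz :: "'a::metric_space measure \<Rightarrow> 'a \<Rightarrow> real" where
  "leibniz \<mu> x = (\<integral>z. (dist x z)\<^sup>2 \<partial>\<mu>)"

definition minimum_point :: "('a \<Rightarrow> real) \<Rightarrow> 'a \<Rightarrow> bool" where
  "minimum_point f b \<longleftrightarrow> (\<forall>x. f b \<le> f x)"

definition barycentre :: "'a::metric_space measure \<Rightarrow> 'a" where
  "barycentre \<mu> = (THE b. minimum_point (leibniz \<mu>) b)"

text \<open>The Bochner integral and the real-valued measure return 0 where the integral or the measure
  is infinite; the moment condition rules this out for every integral and measure used here.\<close>

lemma second_moment_finite: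
  fixes \<mu> :: "'a::metric_space measure"
  assumes sets: "sets \<mu> = sets borel"
    and moment: "(\<integral>\<^sup>+ z. ennreal ((1 + dist x\<^sub>0 z)\<^sup>2) \<partial>\<mu>) < \<infinity>"
  shows finite_measure_of_second_moment: "finite_measure \<mu>"
    and integrable_dist_squared: "integrable \<mu> (\<lambda>z. (dist x z)\<^sup>2)"
proof -
  have meas: "(\<lambda>z. dist y z) \<in> borel_measurable \<mu>" for y
    unfolding measurable_cong_sets[OF sets refl]
    by (intro borel_measurable_continuous_onI continuous_intros)
  note [measurable] = meas
  have int: "integrable \<mu> (\<lambda>z. (1 + dist x\<^sub>0 z)\<^sup>2)"
    using moment by (intro integrableI_bounded) auto
  have "integrable \<mu> (\<lambda>z. 1::real)"
    by (rule Bochner_Integration.integrable_bound[OF int]) (auto intro!: AE_I2)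
  then show "finite_measure \<mu>"
    by (intro finite_measureI) (auto simp: integrable_iff_bounded)
  have "integrable \<mu> (\<lambda>z. (1 + dist x x\<^sub>0)\<^sup>2 * (1 + dist x\<^sub>0 z)\<^sup>2)"
    using int by simp
  then show "integrable \<mu> (\<lambda>z. (dist x z)\<^sup>2)"
  proof (rule Bochner_Integration.integrable_bound)
    have "dist x z \<le> (1 + dist x x\<^sub>0) * (1 + dist x\<^sub>0 z)" for z
    proof -
      have "0 \<le> dist x x\<^sub>0 * dist x\<^sub>0 z" by simp
      then show ?thesis
        using dist_triangle[of x z x\<^sub>0] unfolding distrib_left distrib_right by linarith
    qed
    then show "AE z in \<mu>. norm ((dist x z)\<^sup>2) \<le> norm ((1 + dist x x\<^sub>0)\<^sup>2 * (1 + dist x\<^sub>0 z)\<^sup>2)"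
      by (intro AE_I2) (simp add: power_mult_distrib[symmetric] power_mono)
  qed simp
qed

end

theory Submission
  imports Defs
begin

text \<open>In a \<open>CAT(0)\<close> space the squared distance to any point \<open>z\<close> is strongly convex along a geodesic
  from \<open>x\<close> to \<open>y\<close>: at parameter \<open>s\<close> it lies below its affine interpolation by at least
  \<open>s (1 - s) d(x, y)\<^sup>2\<close> (\<open>dist_squared_strongly_convex\<close>). The plane satisfies this with equality,
  and thinness of triangles transfers it to the space. The quadratic term does not depend on \<open>z\<close>,
  so integration against \<open>\<mu>\<close> shows that the Leibniz function is strongly convex as well, with the
  total mass as its modulus (\<open>leibniz_strongly_convex\<close>).

  The rest is a general fact about continuous, strongly convex functions that are bounded below. At
  the midpoint of two almost minimal points, strong convexity would produce a value below the
  infimum unless the two points are close. Hence every minimizing sequence is Cauchy, and by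
  completeness and continuity its limit is a minimum point (\<open>strongly_convex_attains_minimum\<close>).
  Comparing the minimum \<open>b\<close> with the points at small parameter \<open>s\<close> on the geodesic from \<open>b\<close> to \<open>x\<close>
  gives the variance inequality (\<open>strongly_convex_growth\<close>), and this contains uniqueness.

  Continuity and coercivity use only the triangle inequality and the finiteness of the mass and of
  the second moment.\<close>

section \<open>Comparison with the Euclidean plane\<close>

lemma dist_squared_interpolation:
  fixes x y z :: "'b::real_inner"
  shows "(dist ((1 - s) *\<^sub>R x + s *\<^sub>R y) z)\<^sup>2
    = (1 - s) * (dist x z)\<^sup>2 + s * (dist y z)\<^sup>2 - s * (1 - s) * (dist x y)\<^sup>2"
  unfolding dist_norm power2_norm_eq_inner
  by (simp add: inner_diff_left inner_diff_right inner_add_left inner_add_right inner_commute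
      algebra_simps)

text \<open>The first two vertices are placed on a coordinate axis. The law of cosines then dictates the
  first coordinate \<open>u\<close> of the third vertex, and \<open>\<bar>u\<bar> \<le> dist p r\<close>, which makes room for the second
  coordinate, is a consequence of the triangle inequality.\<close>

lemma comparison_triangle_exists:
  fixes p q r :: "'a::metric_space"
  assumes "p \<noteq> q"
  obtains p' q' r' where "comparison_triangle p q r p' q' r'"
proof -
  define a b c where abc: "a = dist q r" "b = dist r p" "c = dist p q"
  define u where "u = (b\<^sup>2 + c\<^sup>2 - a\<^sup>2) / (2 * c)"
  define v where "v = sqrt (b\<^sup>2 - u\<^sup>2)"
  have c: "c > 0" using assms by (simp add: abc)
  have tri: "a \<le> b + c" "b \<le> a + c" "c \<le> a + b" "a \<ge> 0" "b \<ge> 0"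
    using dist_triangle[of q r p] dist_triangle[of r p q] dist_triangle[of p q r]
    by (auto simp: abc dist_commute)
  have cu: "2 * c * u = b\<^sup>2 + c\<^sup>2 - a\<^sup>2" using c by (simp add: u_def)
  have "(b - c)\<^sup>2 \<le> a\<^sup>2" "a\<^sup>2 \<le> (b + c)\<^sup>2"
    using tri c by (auto simp: abs_le_square_iff[symmetric])
  then have "2 * c * u \<le> 2 * c * b" "2 * c * (- b) \<le> 2 * c * u"
    unfolding cu by (auto simp: power2_eq_square algebra_simps)
  then have "u \<le> b" "- b \<le> u"
    using mult_left_le_imp_le[of "2 * c" u b] mult_left_le_imp_le[of "2 * c" "- b" u] c by auto
  then have "\<bar>u\<bar> \<le> \<bar>b\<bar>" by simp
  then have v: "v\<^sup>2 = b\<^sup>2 - u\<^sup>2" by (simp add: v_def abs_le_square_iff)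
  have "(c - u)\<^sup>2 + v\<^sup>2 = a\<^sup>2" using cu v by (simp add: power2_eq_square algebra_simps)
  then have "comparison_triangle p q r 0 (vector [c, 0]) (vector [u, v])"
    using v c tri
    by (simp add: comparison_triangle_def abc[symmetric] dist_norm norm_eq_sqrt_inner
        inner_vec_def sum_2 power2_eq_square[symmetric])
  then show thesis by (rule that)
qed

text \<open>A point on a side and the vertex opposite to it are compared with their counterparts in the
  plane, where the inequality is an identity.\<close>

lemma dist_squared_strongly_convex:
  fixes x y z :: "'a::cat0_space"
  assumes g: "geodesic_path x y g" and s: "0 \<le> s" "s \<le> 1"
  shows "(dist (g (s * dist x y)) z)\<^sup>2
    \<le> (1 - s) * (dist x z)\<^sup>2 + s * (dist y z)\<^sup>2 - s * (1 - s) * (dist x y)\<^sup>2"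
proof (cases "x = y")
  case True
  then show ?thesis using g by (simp add: geodesic_path_def algebra_simps)
next
  case False
  let ?m = "g (s * dist x y)"
  obtain x' y' z' where c: "comparison_triangle x y z x' y' z'"
    using comparison_triangle_exists[OF False] .
  obtain h k where h: "geodesic_path y z h" and k: "geodesic_path z x k"
    using geodesic_space by metis
  let ?S = "g ` {0..dist x y}" and ?T = "h ` {0..dist y z}" and ?U = "k ` {0..dist z x}"
  let ?m' = "(1 - s) *\<^sub>R x' + s *\<^sub>R y'"
  have tri: "geodesic_triangle x y z ?S ?T ?U"
    using g h k by (auto simp: geodesic_triangle_def geodesic_segment_def)
  have sd: "0 \<le> s * dist x y" "s * dist x y \<le> dist x y"
    using s by (auto simp: mult_left_le_one_le)
  have "dist (g 0) ?m = \<bar>0 - s * dist x y\<bar>" "g 0 = x"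
    using g sd unfolding geodesic_path_def by auto
  then have xm: "dist x ?m = s * dist x y" using sd by simp
  have "x' - ?m' = s *\<^sub>R (x' - y')" by (simp add: algebra_simps)
  then have "dist x' ?m' = s * dist x y"
    using s c by (simp add: dist_norm comparison_triangle_def)
  then have "comparison_on_side x ?S x' y' ?m ?m'"
    using s sd xm by (auto simp: comparison_on_side_def closed_segment_def)
  moreover have "z \<in> ?T" using h by (auto simp: geodesic_path_def intro!: image_eqI[of _ _ "dist y z"])
  then have "comparison_on_side y ?T y' z' z z'"
    using c by (simp add: comparison_on_side_def comparison_triangle_def)
  ultimately have "dist ?m z \<le> dist ?m' z'"
    using triangles_thin[OF tri c] by (auto simp: comparison_point_def)
  then have "(dist ?m z)\<^sup>2 \<le> (dist ?m' z')\<^sup>2" by (simp add: power_mono)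
  also have "\<dots> = (1 - s) * (dist x z)\<^sup>2 + s * (dist y z)\<^sup>2 - s * (1 - s) * (dist x y)\<^sup>2"
    unfolding dist_squared_interpolation
    using c by (simp add: comparison_triangle_def dist_commute)
  finally show ?thesis .
qed

section \<open>Minimization of strongly convex functions\<close>

text \<open>If \<open>f x\<close> and \<open>f y\<close> exceed the infimum by less than \<open>c e\<^sup>2\<close>, then so does their mean. Since
  \<open>f m\<close> is at least the infimum, the midpoint inequality forces \<open>d(x, y) < e\<close>. So a minimizing
  sequence is Cauchy.\<close>

lemma strongly_convex_attains_minimum:
  fixes f :: "'a::metric_space \<Rightarrow> real"
  assumes "complete (UNIV :: 'a set)" and cont: "continuous_on UNIV f"
    and bdd: "bdd_below (range f)" and c: "c > 0"
    and mid: "\<And>x y. \<exists>m. f m \<le> (f x + f y) / 2 - c * (dist x y)\<^sup>2"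
  shows "\<exists>b. minimum_point f b"
proof -
  define I where "I = Inf (range f)"
  have lower: "I \<le> f x" for x using bdd by (auto simp: I_def intro: cInf_lower)
  have "\<exists>x. f x < I + 1 / real (Suc n)" for n
    using cInf_lessD[of "range f" "I + 1 / real (Suc n)"] by (auto simp: I_def)
  then obtain X where X: "f (X n) < I + 1 / real (Suc n)" for n by metis
  have "Cauchy X"
  proof (rule metric_CauchyI)
    fix e :: real assume e: "e > 0"
    obtain N where N: "1 / real (Suc N) < c * e\<^sup>2"
      using nat_approx_posE[of "c * e\<^sup>2"] c e by auto
    have near: "f (X n) < I + c * e\<^sup>2" if "n \<ge> N" for n
    proof -
      have "1 / real (Suc n) \<le> 1 / real (Suc N)" using that by (simp add: field_simps)
      then show ?thesis using X[of n] N by linarith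
    qed
    have "dist (X i) (X j) < e" if "i \<ge> N" "j \<ge> N" for i j
    proof -
      obtain m where "f m \<le> (f (X i) + f (X j)) / 2 - c * (dist (X i) (X j))\<^sup>2"
        using mid by blast
      then have "c * (dist (X i) (X j))\<^sup>2 \<le> (f (X i) + f (X j)) / 2 - f m" by linarith
      also have "\<dots> < c * e\<^sup>2"
        using near[OF that(1)] near[OF that(2)] lower[of m] by (simp add: field_simps)
      finally have "(dist (X i) (X j))\<^sup>2 < e\<^sup>2" using c by simp
      then show ?thesis using e by (simp add: power2_less_imp_less)
    qed
    then show "\<exists>M. \<forall>i\<ge>M. \<forall>j\<ge>M. dist (X i) (X j) < e" by blast
  qed
  then obtain b where b: "X \<longlonglongrightarrow> b" using assms(1) by (auto simp: complete_def)
  have "(\<lambda>n. f (X n)) \<longlonglongrightarrow> f b"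
    using cont b by (simp add: continuous_on_tendsto_compose)
  moreover have "(\<lambda>n. I + 1 / real (Suc n)) \<longlonglongrightarrow> I + 0"
    by (intro tendsto_intros LIMSEQ_Suc lim_1_over_n)
  ultimately have "f b \<le> I + 0"
    by (rule LIMSEQ_le) (use X less_imp_le in blast)
  then have "f b \<le> f x" for x using lower[of x] by linarith
  then show ?thesis by (auto simp: minimum_point_def)
qed

text \<open>The value at parameter \<open>s\<close> on the way from \<open>b\<close> to \<open>x\<close> is at least \<open>f b\<close>, so that
  \<open>s (1 - s) c d(b, x)\<^sup>2 \<le> s (f x - f b)\<close>; divide by \<open>s\<close> and let it tend to \<open>0\<close>.\<close>

lemma strongly_convex_growth:
  fixes f :: "'a::metric_space \<Rightarrow> real"
  assumes b: "minimum_point f b"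
    and conv: "\<And>s. 0 < s \<Longrightarrow> s < 1 \<Longrightarrow>
      \<exists>m. f m \<le> (1 - s) * f b + s * f x - s * (1 - s) * (c * (dist b x)\<^sup>2)"
    and c: "c \<ge> 0"
  shows "(dist b x)\<^sup>2 * c \<le> f x - f b"
proof (rule field_le_mult_one_interval)
  fix t :: real assume t: "0 < t" "t < 1"
  obtain m where m: "f m \<le> t * f b + (1 - t) * f x - (1 - t) * t * (c * (dist b x)\<^sup>2)"
    using conv[of "1 - t"] t by auto
  have "f b \<le> f m" using b by (simp add: minimum_point_def)
  with m have "(1 - t) * (t * ((dist b x)\<^sup>2 * c)) \<le> (1 - t) * (f x - f b)"
    by (simp add: algebra_simps)
  then show "t * ((dist b x)\<^sup>2 * c) \<le> f x - f b" using t by simp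
qed

section \<open>The Leibniz function\<close>

text \<open>The estimate for \<open>d(y, z)\<^sup>2 - d(x, z)\<^sup>2\<close> by \<open>d(x, y) (2 d(x, z) + d(x, y))\<close> is weakened with
  \<open>2 d \<le> 1 + d\<^sup>2\<close>, so that its integral is expressed by the mass and by the Leibniz function.\<close>

lemma dist_squared_diff_bound:
  "\<bar>(dist y z)\<^sup>2 - (dist x z)\<^sup>2\<bar> \<le> dist x y * (1 + (dist x z)\<^sup>2 + dist x y)"
proof -
  have "\<bar>dist y z - dist x z\<bar> \<le> dist x y"
    by (metis abs_dist_diff_le dist_commute)
  moreover have "dist y z + dist x z \<le> 2 * dist x z + dist x y"
    using dist_triangle[of y z x] by (simp add: dist_commute)
  moreover have "2 * dist x z \<le> 1 + (dist x z)\<^sup>2"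
    using zero_le_power2[of "dist x z - 1"] by (simp add: power2_eq_square algebra_simps)
  ultimately have "\<bar>dist y z - dist x z\<bar> * (dist y z + dist x z)
      \<le> dist x y * (1 + (dist x z)\<^sup>2 + dist x y)"
    by (intro mult_mono) auto
  then show ?thesis by (simp add: power2_eq_square square_diff_square_factored abs_mult mult.commute)
qed

context
  fixes \<mu> :: "'a::metric_space measure"
  assumes sets: "sets \<mu> = sets borel"
    and fin: "finite_measure \<mu>"
    and int: "\<And>x. integrable \<mu> (\<lambda>z. (dist x z)\<^sup>2)"
begin

interpretation finite_measure \<mu> by (rule fin)

lemma space_UNIV: "space \<mu> = UNIV"
  using sets_eq_imp_space_eq[OF sets] by simp

lemma leibniz_diff_bound:
  "\<bar>leibniz \<mu> y - leibniz \<mu> x\<bar>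
    \<le> dist x y * (measure \<mu> UNIV + leibniz \<mu> x + dist x y * measure \<mu> UNIV)"
proof -
  have "\<bar>leibniz \<mu> y - leibniz \<mu> x\<bar> = \<bar>\<integral>z. (dist y z)\<^sup>2 - (dist x z)\<^sup>2 \<partial>\<mu>\<bar>"
    using int by (simp add: leibniz_def)
  also have "\<dots> \<le> (\<integral>z. dist x y * (1 + (dist x z)\<^sup>2 + dist x y) \<partial>\<mu>)"
    using int by (intro integral_abs_bound[THEN order_trans] integral_mono dist_squared_diff_bound)
      auto
  also have "\<dots> = dist x y * (measure \<mu> UNIV + leibniz \<mu> x + dist x y * measure \<mu> UNIV)"
    using int by (simp add: leibniz_def space_UNIV mult.commute)
  finally show ?thesis .
qed

lemma continuous_on_leibniz: "continuous_on UNIV (leibniz \<mu>)"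
  unfolding continuous_on_def
proof (intro ballI)
  fix x
  have "((\<lambda>y. dist x y * (measure \<mu> UNIV + leibniz \<mu> x + dist x y * measure \<mu> UNIV)) \<longlongrightarrow>
      dist x x * (measure \<mu> UNIV + leibniz \<mu> x + dist x x * measure \<mu> UNIV)) (at x)"
    by (intro tendsto_intros)
  then have "((\<lambda>y. dist x y * (measure \<mu> UNIV + leibniz \<mu> x + dist x y * measure \<mu> UNIV))
      \<longlongrightarrow> 0) (at x)"
    by (simp only: dist_self mult_zero_left)
  then have "((\<lambda>y. leibniz \<mu> y - leibniz \<mu> x) \<longlongrightarrow> 0) (at x)"
    by (rule Lim_null_comparison[rotated])
      (simp only: real_norm_def leibniz_diff_bound eventually_True)
  then show "(leibniz \<mu> \<longlongrightarrow> leibniz \<mu> x) (at x)" by (simp add: LIM_zero_iff)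
qed

text \<open>The inequality \<open>d(x, w)\<^sup>2 \<le> 2 d(x, z)\<^sup>2 + 2 d(w, z)\<^sup>2\<close>, integrated over \<open>z\<close>.\<close>

lemma leibniz_quadratic_growth:
  "(dist x w)\<^sup>2 * measure \<mu> UNIV \<le> 2 * leibniz \<mu> x + 2 * leibniz \<mu> w"
proof -
  have "(dist x w)\<^sup>2 \<le> 2 * (dist x z)\<^sup>2 + 2 * (dist w z)\<^sup>2" for z
  proof -
    have "(dist x w)\<^sup>2 \<le> (dist x z + dist w z)\<^sup>2"
      using dist_triangle2[of x w z] by (simp add: power_mono)
    also have "\<dots> \<le> 2 * (dist x z)\<^sup>2 + 2 * (dist w z)\<^sup>2"
      using sum_squares_bound[of "dist x z" "dist w z"] by (simp add: power2_sum)
    finally show ?thesis .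
  qed
  then have "(\<integral>z. (dist x w)\<^sup>2 \<partial>\<mu>) \<le> (\<integral>z. 2 * (dist x z)\<^sup>2 + 2 * (dist w z)\<^sup>2 \<partial>\<mu>)"
    using int by (intro integral_mono) auto
  then show ?thesis using int by (simp add: leibniz_def space_UNIV mult.commute)
qed

lemma leibniz_tends_to_infinity:
  assumes "measure \<mu> UNIV > 0"
  shows "filterlim (leibniz \<mu>) at_top (filtercomap (\<lambda>x. dist x w) at_top)"
proof -
  let ?F = "filtercomap (\<lambda>x. dist x w) at_top"
  have d: "filterlim (\<lambda>x. dist x w) at_top ?F" by (rule filterlim_filtercomap)
  have "filterlim (\<lambda>x. - leibniz \<mu> w + measure \<mu> UNIV / 2 * (dist x w)\<^sup>2) at_top ?F"
    using assms
    by (intro filterlim_tendsto_add_at_top[OF tendsto_const]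
        filterlim_tendsto_pos_mult_at_top[OF tendsto_const] filterlim_pow_at_top d) auto
  then show ?thesis
  proof (rule filterlim_at_top_mono)
    show "\<forall>\<^sub>F x in ?F. - leibniz \<mu> w + measure \<mu> UNIV / 2 * (dist x w)\<^sup>2 \<le> leibniz \<mu> x"
      using leibniz_quadratic_growth[of _ w]
      by (intro always_eventually allI) (simp add: field_simps)
  qed
qed

end

text \<open>The correction \<open>s (1 - s) d(x, y)\<^sup>2\<close> is constant in the variable of integration, so the mass
  becomes the modulus of convexity.\<close>

lemma leibniz_strongly_convex:
  fixes \<mu> :: "'a::cat0_space measure"
  assumes sets: "sets \<mu> = sets borel" and fin: "finite_measure \<mu>"
    and int: "\<And>x. integrable \<mu> (\<lambda>z. (dist x z)\<^sup>2)"
    and s: "0 \<le> s" "s \<le> 1"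
  shows "\<exists>m. leibniz \<mu> m \<le> (1 - s) * leibniz \<mu> x + s * leibniz \<mu> y
    - s * (1 - s) * (measure \<mu> UNIV * (dist x y)\<^sup>2)"
proof -
  interpret finite_measure \<mu> by (rule fin)
  obtain g where g: "geodesic_path x y g" using geodesic_space by blast
  have "leibniz \<mu> (g (s * dist x y))
      \<le> (\<integral>z. (1 - s) * (dist x z)\<^sup>2 + s * (dist y z)\<^sup>2 - s * (1 - s) * (dist x y)\<^sup>2 \<partial>\<mu>)"
    unfolding leibniz_def
    using int by (intro integral_mono dist_squared_strongly_convex[OF g s]) auto
  also have "\<dots> = (1 - s) * leibniz \<mu> x + s * leibniz \<mu> y
      - s * (1 - s) * (measure \<mu> UNIV * (dist x y)\<^sup>2)"
    using int by (simp add: leibniz_def space_UNIV[OF sets fin int] mult_ac)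
  finally show ?thesis by blast
qed

theorem proposition6p7:
  fixes \<mu> :: "'a::cat0_space measure" and x\<^sub>0 :: 'a
  assumes "sets \<mu> = sets borel"
    and "emeasure \<mu> UNIV > 0"
    and "(\<integral>\<^sup>+ z. ennreal ((1 + dist x\<^sub>0 z)\<^sup>2) \<partial>\<mu>) < \<infinity>"
  shows "continuous_on UNIV (leibniz \<mu>) \<and>
    filterlim (leibniz \<mu>) at_top (filtercomap (\<lambda>x. dist x x\<^sub>0) at_top) \<and>
    (complete (UNIV :: 'a set) \<longrightarrow>
      (\<exists>!b. minimum_point (leibniz \<mu>) b) \<and>
      (\<forall>x. (dist (barycentre \<mu>) x)\<^sup>2 * measure \<mu> UNIV
             \<le> leibniz \<mu> x - leibniz \<mu> (barycentre \<mu>)))"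
proof -
  have fin: "finite_measure \<mu>" and int: "integrable \<mu> (\<lambda>z. (dist x z)\<^sup>2)" for x
    using second_moment_finite[OF assms(1,3)] by auto
  note hyps = assms(1) fin int
  have mass: "measure \<mu> UNIV > 0"
    using assms(2) finite_measure.emeasure_eq_measure[OF fin] by simp
  note cont = continuous_on_leibniz[OF hyps]
  note conv = leibniz_strongly_convex[OF hyps]
  have growth: "(dist b x)\<^sup>2 * measure \<mu> UNIV \<le> leibniz \<mu> x - leibniz \<mu> b"
    if "minimum_point (leibniz \<mu>) b" for b x
    using that by (rule strongly_convex_growth) (use conv mass in auto)
  have min: "\<exists>!b. minimum_point (leibniz \<mu>) b" if "complete (UNIV :: 'a set)"
  proof (rule ex_ex1I)
    have "bdd_below (range (leibniz \<mu>))"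
      by (intro bdd_belowI[of _ 0]) (auto simp: leibniz_def)
    moreover have "\<exists>m. leibniz \<mu> m
        \<le> (leibniz \<mu> x + leibniz \<mu> y) / 2 - measure \<mu> UNIV / 4 * (dist x y)\<^sup>2" for x y
      using conv[of "1/2" x y] by (simp add: field_simps)
    ultimately show "\<exists>b. minimum_point (leibniz \<mu>) b"
      using strongly_convex_attains_minimum[OF that cont, of "measure \<mu> UNIV / 4"] mass by auto
  next
    fix b b' assume b: "minimum_point (leibniz \<mu>) b" and "minimum_point (leibniz \<mu>) b'"
    then have "leibniz \<mu> b' - leibniz \<mu> b \<le> 0" by (simp add: minimum_point_def)
    with growth[OF b, of b'] have "(dist b b')\<^sup>2 * measure \<mu> UNIV \<le> 0" by linarith
    then show "b = b'" using mass by (simp add: mult_le_0_iff)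
  qed
  have "minimum_point (leibniz \<mu>) (barycentre \<mu>)" if "complete (UNIV :: 'a set)"
    unfolding barycentre_def by (rule theI'[OF min[OF that]])
  then show ?thesis
    by (intro conjI impI allI cont leibniz_tends_to_infinity[OF hyps mass] min growth)
qed

end
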